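(* Let $\mathbf{X}$ be a random $p_L\times p_R$ matrix and $Y$ a random variable. Suppose that $\mathbf{U}$ is a random matrix in $\mathbb{R}^{p_Lp_R\times k}$ such that $\mathrm{span}(\mathbf{U})\subseteq\mathcal{S}_{Y|\mathrm{vec}(\mathbf{X})}$ almost surely. Then $$\mathcal{E}^{\otimes}(\mathbf{U})\subseteq\mathcal{S}_{Y|\circ\mathbf{X}\circ}$$ and, consequently, $\mathcal{S}_{\circ\mathbf{U}}\subseteq\mathcal{S}_{Y|\circ\mathbf{X}}$ and $\mathcal{S}_{\mathbf{U}\circ}\subseteq\mathcal{S}_{Y|\mathbf{X}\circ}$.
   Context: Notation: $\mathrm{span}(\mathbf{A})$ is the column space of $\mathbf{A}$; $\mathbf{P}_{\mathcal{S}}$ is the orthogonal projection matrix onto a subspace $\mathcal{S}$; $\mathrm{vec}(\mathbf{X})$ stacks the columns of $\mathbf{X}$; $\perp\!\!\!\perp$ denotes (conditional) independence. For linear subspaces $\mathcal{S}_1,\mathcal{S}_2$ of Euclidean spaces, $\mathcal{S}_1\otimes\mathcal{S}_2$ is the linear span of $\{\mathbf{v}_1\otimes\mathbf{v}_2:\mathbf{v}_1\in\mathcal{S}_1,\mathbf{v}_2\in\mathcal{S}_2\}$ (Kronecker products). Dimension-folding subspaces: if subspaces $\mathcal{S}_L\subseteq\mathbb{R}^{p_L}$ and $\mathcal{S}_R\subseteq\mathbb{R}^{p_R}$ satisfy $Y\perp\!\!\!\perp\mathbf{X}\mid\mathbf{P}_{\mathcal{S}_L}\mathbf{X}\mathbf{P}_{\mathcal{S}_R}$,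 then $\mathcal{S}_L$ is called a left, and $\mathcal{S}_R$ a right, dimension-folding subspace for $Y|\mathbf{X}$. $\mathcal{S}_{Y|\circ\mathbf{X}}$ is the intersection of all left dimension-folding subspaces, $\mathcal{S}_{Y|\mathbf{X}\circ}$ is the intersection of all right dimension-folding subspaces, and the (central) dimension-folding subspace is $\mathcal{S}_{Y|\circ\mathbf{X}\circ}=\mathcal{S}_{Y|\mathbf{X}\circ}\otimes\mathcal{S}_{Y|\circ\mathbf{X}}$. Standing assumption: the intersections are themselves dimension-folding subspaces and the pair $(\mathcal{S}_L,\mathcal{S}_R)=(\mathcal{S}_{Y|\circ\mathbf{X}},\mathcal{S}_{Y|\mathbf{X}\circ})$ satisfies $Y\perp\!\!\!\perp\mathbf{X}\mid\mathbf{P}_{\mathcal{S}_L}\mathbf{X}\mathbf{P}_{\mathcal{S}_R}$. Conventional dimension reduction subspace: $\mathcal{S}_{Y|\mathrm{vec}(\mathbf{X})}$ is the intersection of all subspaces $\mathcal{S}\subseteq\mathbb{R}^{p_Lp_R}$ with $Y\perp\!\!\!\perp\mathrm{vec}(\mathbf{X})\mid\mathbf{P}_{\mathcal{S}}\mathrm{vec}(\mathbf{X})$, and it is assumed to satisfy this relation itself. Kronecker envelope: for a random matrix $\mathbf{U}\in\mathbb{R}^{p_Rp_L\times k}$ there exist subspaces $\mathcal{S}_{\mathbf{U}\circ}\subseteq\mathbb{R}^{p_R}$ and $\mathcal{S}_{\circ\mathbf{U}}\subseteq\mathbb{R}^{p_L}$ such that $\mathrm{span}(\mathbf{U})\subseteq\mathcal{S}_{\mathbf{U}\circ}\otimes\mathcal{S}_{\circ\mathbf{U}}$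 almost surely and $\mathcal{S}_{\mathbf{U}\circ}\otimes\mathcal{S}_{\circ\mathbf{U}}\subseteq\mathcal{S}_R\otimes\mathcal{S}_L$ for every other pair $\mathcal{S}_R\subseteq\mathbb{R}^{p_R}$, $\mathcal{S}_L\subseteq\mathbb{R}^{p_L}$ with $\mathrm{span}(\mathbf{U})\subseteq\mathcal{S}_R\otimes\mathcal{S}_L$ almost surely. The uniquely determined space $\mathcal{E}^{\otimes}(\mathbf{U})=\mathcal{S}_{\mathbf{U}\circ}\otimes\mathcal{S}_{\circ\mathbf{U}}$ is the Kronecker envelope of $\mathbf{U}$. *)

theory Defs
  imports "HOL-Probability.Probability"
begin

section \<open>Kronecker products, vectorization and projections\<close>

text \<open>
  A \<open>p\<^sub>L \<times> p\<^sub>R\<close> matrix has type \<^typ>\<open>real^'r^'l\<close>. Vectors in \<open>\<real>\<^bsup>p\<^sub>R p\<^sub>L\<^esup>\<close> are indexed by pairs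
  \<open>(j, i)\<close> of a column index \<open>j\<close> and a row index \<open>i\<close>; ordered lexicographically, this is the
  order in which \<open>vec(X)\<close> stacks the columns of \<open>X\<close>, and also the order of the entries of the
  Kronecker product of a vector in \<open>\<real>\<^bsup>p\<^sub>R\<^esup>\<close> with a vector in \<open>\<real>\<^bsup>p\<^sub>L\<^esup>\<close>.
\<close>

definition vectorize :: "real^'r::finite^'l::finite \<Rightarrow> real^('r \<times> 'l)" where
  "vectorize X = (\<chi> p. X $ snd p $ fst p)"

definition kron :: "real^'r::finite \<Rightarrow> real^'l::finite \<Rightarrow> real^('r \<times> 'l)" where
  "kron v w = (\<chi> p. v $ fst p * w $ snd p)"

definition kron_space ::
    "(real^'r::finite) set \<Rightarrow> (real^'l::finite) set \<Rightarrow> (real^('r \<times> 'l)) set" (infixr "\<otimes>\<^sub>K" 70) where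
  "SR \<otimes>\<^sub>K SL = span {kron v w | v w. v \<in> SR \<and> w \<in> SL}"

definition proj_mat :: "(real^'n::finite) set \<Rightarrow> real^'n^'n" where
  "proj_mat S = (THE P. \<forall>x. P *v x \<in> S \<and> (\<forall>y\<in>S. orthogonal (x - P *v x) y))"


section \<open>Conditional independence\<close>

text \<open>\<open>Y \<bottom> X | Z\<close>, where conditioning on \<open>Z\<close> is conditioning on the sigma-algebra generated by \<open>Z\<close>.\<close>

definition cond_indep_var ::
    "'a measure \<Rightarrow> 'y measure \<Rightarrow> ('a \<Rightarrow> 'y) \<Rightarrow> 'x measure \<Rightarrow> ('a \<Rightarrow> 'x) \<Rightarrow> 'z measure \<Rightarrow> ('a \<Rightarrow> 'z) \<Rightarrow> bool"
  where
  "cond_indep_var M N Y K X L Z \<longleftrightarrow>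
     Y \<in> measurable M N \<and> X \<in> measurable M K \<and> Z \<in> measurable M L \<and>
     (\<forall>A\<in>sets N. \<forall>B\<in>sets K. AE \<omega> in M.
        real_cond_exp M (vimage_algebra (space M) Z L) (indicator (Y -` A \<inter> X -` B)) \<omega> =
        real_cond_exp M (vimage_algebra (space M) Z L) (indicator (Y -` A)) \<omega> *
        real_cond_exp M (vimage_algebra (space M) Z L) (indicator (X -` B)) \<omega>)"


section \<open>Dimension reduction and dimension folding subspaces\<close>

definition dim_reduction_subspace ::
    "'a measure \<Rightarrow> 'y measure \<Rightarrow> ('a \<Rightarrow> 'y) \<Rightarrow> ('a \<Rightarrow> real^'n::finite) \<Rightarrow> (real^'n) set \<Rightarrow> bool" where
  "dim_reduction_subspace M N Y V S \<longleftrightarrow>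
     subspace S \<and> cond_indep_var M N Y borel V borel (\<lambda>\<omega>. proj_mat S *v V \<omega>)"

definition central_subspace ::
    "'a measure \<Rightarrow> 'y measure \<Rightarrow> ('a \<Rightarrow> 'y) \<Rightarrow> ('a \<Rightarrow> real^'n::finite) \<Rightarrow> (real^'n) set" where
  "central_subspace M N Y V = \<Inter> {S. dim_reduction_subspace M N Y V S}"

definition dim_folding_pair ::
    "'a measure \<Rightarrow> 'y measure \<Rightarrow> ('a \<Rightarrow> 'y) \<Rightarrow> ('a \<Rightarrow> real^'r::finite^'l::finite) \<Rightarrow>
     (real^'l) set \<Rightarrow> (real^'r) set \<Rightarrow> bool" where
  "dim_folding_pair M N Y X SL SR \<longleftrightarrow>
     subspace SL \<and> subspace SR \<and>
     cond_indep_var M N Y borel X borel (\<lambda>\<omega>. proj_mat SL ** X \<omega> ** proj_mat SR)"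

definition central_left_folding ::
    "'a measure \<Rightarrow> 'y measure \<Rightarrow> ('a \<Rightarrow> 'y) \<Rightarrow> ('a \<Rightarrow> real^'r::finite^'l::finite) \<Rightarrow> (real^'l) set" where
  "central_left_folding M N Y X = \<Inter> {SL. \<exists>SR. dim_folding_pair M N Y X SL SR}"

definition central_right_folding ::
    "'a measure \<Rightarrow> 'y measure \<Rightarrow> ('a \<Rightarrow> 'y) \<Rightarrow> ('a \<Rightarrow> real^'r::finite^'l::finite) \<Rightarrow> (real^'r) set" where
  "central_right_folding M N Y X = \<Inter> {SR. \<exists>SL. dim_folding_pair M N Y X SL SR}"

definition central_folding_subspace ::
    "'a measure \<Rightarrow> 'y measure \<Rightarrow> ('a \<Rightarrow> 'y) \<Rightarrow> ('a \<Rightarrow> real^'r::finite^'l::finite) \<Rightarrow>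
     (real^('r \<times> 'l)) set" where
  "central_folding_subspace M N Y X = central_right_folding M N Y X \<otimes>\<^sub>K central_left_folding M N Y X"


section \<open>The Kronecker envelope of a random matrix\<close>

definition kron_envelope_pair ::
    "'a measure \<Rightarrow> ('a \<Rightarrow> real^'k::finite^('r::finite \<times> 'l::finite)) \<Rightarrow>
     (real^'r) set \<Rightarrow> (real^'l) set \<Rightarrow> bool" where
  "kron_envelope_pair M U SR SL \<longleftrightarrow>
     subspace SR \<and> subspace SL \<and>
     (AE \<omega> in M. span (columns (U \<omega>)) \<subseteq> SR \<otimes>\<^sub>K SL) \<and>
     (\<forall>TR TL. subspace TR \<and> subspace TL \<and> (AE \<omega> in M. span (columns (U \<omega>)) \<subseteq> TR \<otimes>\<^sub>K TL) \<longrightarrow>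
        SR \<otimes>\<^sub>K SL \<subseteq> TR \<otimes>\<^sub>K TL)"

text \<open>
  A nonzero Kronecker product of subspaces determines both factors, but the zero space is the
  product of \<open>{0}\<close> with any subspace. In that degenerate case (\<open>U = 0\<close> almost surely) both factors
  of the envelope are taken to be \<open>{0}\<close>; the second conjunct below has no other effect.
\<close>

definition kron_envelope_factors ::
    "'a measure \<Rightarrow> ('a \<Rightarrow> real^'k::finite^('r::finite \<times> 'l::finite)) \<Rightarrow>
     (real^'r) set \<times> (real^'l) set" where
  "kron_envelope_factors M U =
     (THE (SR, SL). kron_envelope_pair M U SR SL \<and> (SR = {0} \<longleftrightarrow> SL = {0}))"

definition kron_envelope_right ::
    "'a measure \<Rightarrow> ('a \<Rightarrow> real^'k::finite^('r::finite \<times> 'l::finite)) \<Rightarrow> (real^'r) set" where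
  "kron_envelope_right M U = fst (kron_envelope_factors M U)"

definition kron_envelope_left ::
    "'a measure \<Rightarrow> ('a \<Rightarrow> real^'k::finite^('r::finite \<times> 'l::finite)) \<Rightarrow> (real^'l) set" where
  "kron_envelope_left M U = snd (kron_envelope_factors M U)"

definition kron_envelope ::
    "'a measure \<Rightarrow> ('a \<Rightarrow> real^'k::finite^('r::finite \<times> 'l::finite)) \<Rightarrow> (real^('r \<times> 'l)) set" where
  "kron_envelope M U = kron_envelope_right M U \<otimes>\<^sub>K kron_envelope_left M U"


section \<open>Well-definedness\<close>

lemma proj_mat:
  fixes S :: "(real^'n::finite) set"
  assumes "subspace S"
  shows "proj_mat S *v x \<in> S" and "y \<in> S \<Longrightarrow> orthogonal (x - proj_mat S *v x) y"
proof -
  obtain B where B: "B \<subseteq> S" "pairwise orthogonal B" "\<And>x. x \<in> B \<Longrightarrow> norm x = 1"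
    "independent B" "span B = S"
    using orthonormal_basis_subspace[OF assms] by metis
  have fin: "finite B" using B(4) by (rule independent_imp_finite)
  define f where "f x = (\<Sum>b\<in>B. (b \<bullet> x) *\<^sub>R b)" for x :: "real^'n"
  have "linear f"
    by (rule linearI)
      (simp_all add: f_def inner_add_right scaleR_left_distrib sum.distrib scaleR_sum_right)
  then have f: "matrix f *v x = f x" for x by (simp add: matrix_works linear_matrix_vector_mul_eq)
  have fS: "f x \<in> S" for x
    unfolding f_def using B(1) assms by (auto intro!: subspace_sum subspace_scale)
  have f_basis: "orthogonal (x - f x) c" if "c \<in> B" for x c
  proof -
    have "b \<bullet> c = (if b = c then 1 else 0)" if "b \<in> B" for b
      using B(2,3) \<open>c \<in> B\<close> that by (auto simp: pairwise_def orthogonal_def norm_eq_1)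
    then have "(\<Sum>b\<in>B. (b \<bullet> x) * (b \<bullet> c)) = (\<Sum>b\<in>B. if b = c then c \<bullet> x else 0)"
      by (intro sum.cong) auto
    also have "\<dots> = c \<bullet> x" using fin that by simp
    finally have "f x \<bullet> c = c \<bullet> x" by (simp add: f_def inner_sum_left)
    then show ?thesis by (simp add: orthogonal_def inner_diff_left inner_commute[of x c])
  qed
  have f_orth: "orthogonal (x - f x) y" if "y \<in> S" for x y
    using that B(5) f_basis by (metis orthogonal_to_span)
  have "\<exists>!P. \<forall>x. P *v x \<in> S \<and> (\<forall>y\<in>S. orthogonal (x - P *v x) y)"
  proof (rule ex1I[of _ "matrix f"])
    show "\<forall>x. matrix f *v x \<in> S \<and> (\<forall>y\<in>S. orthogonal (x - matrix f *v x) y)"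
      using fS f_orth by (simp add: f)
  next
    fix P :: "real^'n^'n" assume P: "\<forall>x. P *v x \<in> S \<and> (\<forall>y\<in>S. orthogonal (x - P *v x) y)"
    have "P *v x = f x" for x
    proof -
      define d where "d = P *v x - f x"
      have "d \<in> S" using P fS assms by (simp add: d_def subspace_diff)
      then have "(x - f x) \<bullet> d = 0" "(x - P *v x) \<bullet> d = 0"
        using P f_orth by (auto simp: orthogonal_def)
      then have "d \<bullet> d = 0" by (simp add: d_def inner_diff_left)
      then show ?thesis by (simp add: d_def)
    qed
    then show "P = matrix f" by (simp add: matrix_eq f)
  qed
  note P = theI'[OF this, folded proj_mat_def]
  show "proj_mat S *v x \<in> S" using P by blast
  show "orthogonal (x - proj_mat S *v x) y" if "y \<in> S" using P that by blast
qed

lemma subspace_kron_space: "subspace (SR \<otimes>\<^sub>K SL)"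
  by (simp add: kron_space_def)

lemma mem_kron_space_iff:
  fixes z :: "real^('r::finite \<times> 'l::finite)"
  assumes R: "subspace SR" and L: "subspace SL"
  shows "z \<in> SR \<otimes>\<^sub>K SL \<longleftrightarrow> (\<forall>j. (\<chi> i. z $ (j, i)) \<in> SL) \<and> (\<forall>i. (\<chi> j. z $ (j, i)) \<in> SR)"
    (is "_ \<longleftrightarrow> ?P z")
proof
  assume "z \<in> SR \<otimes>\<^sub>K SL"
  then show "?P z"
    unfolding kron_space_def
  proof (induction rule: span_induct)
    case base
    have a: "(\<chi> i. (x + y) $ (j, i)) = (\<chi> i. x $ (j, i)) + (\<chi> i. y $ (j, i))"
      "(\<chi> i. (c *\<^sub>R x) $ (j, i)) = c *\<^sub>R (\<chi> i. x $ (j, i))"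
      "(\<chi> i. (0::real^('r \<times> 'l)) $ (j, i)) = 0"
      for x y :: "real^('r \<times> 'l)" and c j by (simp_all add: vec_eq_iff)
    have b: "(\<chi> j. (x + y) $ (j, i)) = (\<chi> j. x $ (j, i)) + (\<chi> j. y $ (j, i))"
      "(\<chi> j. (c *\<^sub>R x) $ (j, i)) = c *\<^sub>R (\<chi> j. x $ (j, i))"
      "(\<chi> j. (0::real^('r \<times> 'l)) $ (j, i)) = 0"
      for x y :: "real^('r \<times> 'l)" and c i by (simp_all add: vec_eq_iff)
    show ?case
      unfolding subspace_def mem_Collect_eq a b
      using R L by (auto simp: subspace_def)
  next
    case (step x)
    then obtain v w where x: "x = kron v w" "v \<in> SR" "w \<in> SL" by auto
    have "(\<chi> i. x $ (j, i)) = (v $ j) *\<^sub>R w" for j by (simp add: x kron_def vec_eq_iff)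
    moreover have "(\<chi> j. x $ (j, i)) = (w $ i) *\<^sub>R v" for i by (simp add: x kron_def vec_eq_iff)
    ultimately show ?case using x R L by (simp add: subspace_scale)
  qed
next
  assume P: "?P z"
  obtain B where B: "B \<subseteq> SR" "pairwise orthogonal B" "\<And>x. x \<in> B \<Longrightarrow> norm x = 1"
    "independent B" "span B = SR"
    using orthonormal_basis_subspace[OF R] by metis
  have fin: "finite B" using B(4) by (rule independent_imp_finite)
  define w where "w b = (\<Sum>j\<in>UNIV. (b $ j) *\<^sub>R (\<chi> i. z $ (j, i)))" for b :: "real^'r"
  have w: "w b \<in> SL" for b
    unfolding w_def using P L by (auto intro: subspace_sum subspace_scale)
  have wi: "w b $ i = b \<bullet> (\<chi> j. z $ (j, i))" for b i
    by (simp add: w_def inner_vec_def)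
  have expand: "(\<chi> j. z $ (j, i)) = (\<Sum>b\<in>B. (b \<bullet> (\<chi> j. z $ (j, i))) *\<^sub>R b)" for i
  proof -
    define s where "s = (\<chi> j. z $ (j, i))"
    define d where "d = s - (\<Sum>b\<in>B. (b \<bullet> s) *\<^sub>R b)"
    have "s \<in> SR" using P by (simp add: s_def)
    then have "d \<in> span B"
      unfolding d_def using B R by (auto intro!: subspace_diff subspace_sum subspace_scale)
    moreover have "orthogonal d c" if "c \<in> B" for c
    proof -
      have "b \<bullet> c = (if b = c then 1 else 0)" if "b \<in> B" for b
        using B(2,3) \<open>c \<in> B\<close> that by (auto simp: pairwise_def orthogonal_def norm_eq_1)
      then have "(\<Sum>b\<in>B. (b \<bullet> s) * (b \<bullet> c)) = (\<Sum>b\<in>B. if b = c then c \<bullet> s else 0)"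
        by (intro sum.cong) auto
      also have "\<dots> = c \<bullet> s" using fin that by simp
      finally have "(\<Sum>b\<in>B. (b \<bullet> s) * (b \<bullet> c)) = c \<bullet> s" .
      moreover have "d \<bullet> c = s \<bullet> c - (\<Sum>b\<in>B. (b \<bullet> s) * (b \<bullet> c))"
        by (simp add: d_def inner_diff_left inner_sum_left)
      ultimately show ?thesis by (simp add: orthogonal_def inner_commute[of s c])
    qed
    ultimately have "orthogonal d d" by (meson orthogonal_to_span)
    then have "d = 0" by (simp only: orthogonal_self)
    then show ?thesis by (simp add: d_def s_def)
  qed
  have "z = (\<Sum>b\<in>B. kron b (w b))"
  proof -
    have "z $ (j, i) = (\<Sum>b\<in>B. kron b (w b)) $ (j, i)" for j i
    proof -
      have "z $ (j, i) = (\<chi> j. z $ (j, i)) $ j" by simp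
      also have "\<dots> = (\<Sum>b\<in>B. (b \<bullet> (\<chi> j. z $ (j, i))) *\<^sub>R b) $ j" by (subst expand) simp
      also have "\<dots> = (\<Sum>b\<in>B. kron b (w b)) $ (j, i)" by (simp add: kron_def wi mult.commute)
      finally show ?thesis .
    qed
    then show ?thesis by (metis vec_eq_iff surj_pair)
  qed
  also have "\<dots> \<in> SR \<otimes>\<^sub>K SL"
    using B(1) w by (intro subspace_sum subspace_kron_space) (auto simp: kron_space_def intro!: span_base)
  finally show "z \<in> SR \<otimes>\<^sub>K SL" .
qed

lemma kron_space_Int:
  assumes "subspace SR" "subspace SL" "subspace TR" "subspace TL"
  shows "(SR \<inter> TR) \<otimes>\<^sub>K (SL \<inter> TL) = (SR \<otimes>\<^sub>K SL) \<inter> (TR \<otimes>\<^sub>K TL)"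
  using assms by (auto simp: mem_kron_space_iff subspace_inter)

lemma kron_space_zero: "SR = {0} \<or> SL = {0} \<Longrightarrow> SR \<otimes>\<^sub>K SL \<subseteq> {0}"
proof -
  assume "SR = {0} \<or> SL = {0}"
  then have "{kron v w | v w. v \<in> SR \<and> w \<in> SL} \<subseteq> {0}" by (auto simp: kron_def vec_eq_iff)
  then show ?thesis unfolding kron_space_def by (rule span_minimal) (rule subspace_single_0)
qed

lemma kron_space_subset_factors:
  assumes "subspace SR" "subspace SL" "subspace TR" "subspace TL"
    and sub: "SR \<otimes>\<^sub>K SL \<subseteq> TR \<otimes>\<^sub>K TL" and "SR \<noteq> {0}" "SL \<noteq> {0}"
  shows "SR \<subseteq> TR" "SL \<subseteq> TL"
proof -
  have mem: "kron v w \<in> TR \<otimes>\<^sub>K TL" if "v \<in> SR" "w \<in> SL" for v w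
    using that sub by (auto simp: kron_space_def intro: span_base)
  obtain v where "v \<in> SR" "v \<noteq> 0" using assms subspace_0[of SR] by auto
  then obtain j where j: "v $ j \<noteq> 0" by (auto simp: vec_eq_iff)
  obtain w where "w \<in> SL" "w \<noteq> 0" using assms subspace_0[of SL] by auto
  then obtain i where i: "w $ i \<noteq> 0" by (auto simp: vec_eq_iff)
  show "SL \<subseteq> TL"
  proof
    fix l assume "l \<in> SL"
    then have "(\<chi> i. kron v l $ (j, i)) \<in> TL"
      using mem[OF \<open>v \<in> SR\<close>] assms by (simp add: mem_kron_space_iff)
    moreover have "(\<chi> i. kron v l $ (j, i)) = (v $ j) *\<^sub>R l" by (simp add: kron_def vec_eq_iff)
    ultimately have "(1 / v $ j) *\<^sub>R (v $ j) *\<^sub>R l \<in> TL" using assms by (simp only: subspace_scale)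
    then show "l \<in> TL" using j by simp
  qed
  show "SR \<subseteq> TR"
  proof
    fix r assume "r \<in> SR"
    then have "(\<chi> j. kron r w $ (j, i)) \<in> TR"
      using mem[OF _ \<open>w \<in> SL\<close>] assms by (simp add: mem_kron_space_iff)
    moreover have "(\<chi> j. kron r w $ (j, i)) = (w $ i) *\<^sub>R r" by (simp add: kron_def vec_eq_iff)
    ultimately have "(1 / w $ i) *\<^sub>R (w $ i) *\<^sub>R r \<in> TR" using assms by (simp only: subspace_scale)
    then show "r \<in> TR" using i by simp
  qed
qed

lemma kron_envelope_factors_ex1:
  fixes U :: "'a \<Rightarrow> real^'k::finite^('r::finite \<times> 'l::finite)"
  shows "\<exists>!p. case p of (SR, SL) \<Rightarrow> kron_envelope_pair M U SR SL \<and> (SR = {0} \<longleftrightarrow> SL = {0})"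
proof -
  define F where "F = {(SR, SL). subspace SR \<and> subspace SL \<and>
    (AE \<omega> in M. span (columns (U \<omega>)) \<subseteq> SR \<otimes>\<^sub>K SL)}"
  have "(UNIV, UNIV) \<in> F" by (simp add: F_def mem_kron_space_iff subset_iff)
  then obtain p where p: "p \<in> F"
    and min: "\<And>q. q \<in> F \<Longrightarrow> dim (fst p) + dim (snd p) \<le> dim (fst q) + dim (snd q)"
    using ex_has_least_nat[of "\<lambda>p. p \<in> F" _ "\<lambda>p. dim (fst p) + dim (snd p)"] by blast
  obtain SR SL where pe: "p = (SR, SL)" by force
  have S: "subspace SR" "subspace SL" "AE \<omega> in M. span (columns (U \<omega>)) \<subseteq> SR \<otimes>\<^sub>K SL"
    using p by (auto simp: pe F_def)
  have least: "SR \<subseteq> TR \<and> SL \<subseteq> TL" if T: "(TR, TL) \<in> F" for TR TL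
  proof -
    have "(SR \<inter> TR, SL \<inter> TL) \<in> F" using S T by (auto simp: F_def kron_space_Int subspace_inter)
    from min[OF this] have "dim SR + dim SL \<le> dim (SR \<inter> TR) + dim (SL \<inter> TL)" by (simp add: pe)
    moreover have "dim (SR \<inter> TR) \<le> dim SR" "dim (SL \<inter> TL) \<le> dim SL" by (auto intro: dim_subset)
    ultimately have "dim SR \<le> dim (SR \<inter> TR)" "dim SL \<le> dim (SL \<inter> TL)" by linarith+
    moreover have "subspace (SR \<inter> TR)" "subspace (SL \<inter> TL)"
      using S T by (auto simp: F_def subspace_inter)
    ultimately have "SR \<inter> TR = SR" "SL \<inter> TL = SL"
      using subspace_dim_equal[of "SR \<inter> TR" SR] subspace_dim_equal[of "SL \<inter> TL" SL] S by blast+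
    then show ?thesis by auto
  qed
  have "SR \<otimes>\<^sub>K SL \<subseteq> TR \<otimes>\<^sub>K TL" if "(TR, TL) \<in> F" for TR TL
    using least[OF that] unfolding kron_space_def by (intro span_mono) auto
  then have env: "kron_envelope_pair M U SR SL" using S by (auto simp: kron_envelope_pair_def F_def)
  have zero: "SR = {0} \<and> SL = {0}" if "SR = {0} \<or> SL = {0}"
  proof -
    have "SR \<otimes>\<^sub>K SL \<subseteq> {0} \<otimes>\<^sub>K {0}"
      using kron_space_zero[OF that] subspace_0[OF subspace_kron_space[of "{0}" "{0}"]] by blast
    then have "({0}, {0}) \<in> F" using S(3) by (auto simp: F_def)
    from least[OF this] show ?thesis using subspace_0[OF S(1)] subspace_0[OF S(2)] by auto
  qed
  show ?thesis
  proof (rule ex1I[of _ "(SR, SL)"])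
    show "case (SR, SL) of (SR, SL) \<Rightarrow> kron_envelope_pair M U SR SL \<and> (SR = {0} \<longleftrightarrow> SL = {0})"
      unfolding prod.case using env zero by blast
  next
    fix q assume q: "case q of (SR, SL) \<Rightarrow> kron_envelope_pair M U SR SL \<and> (SR = {0} \<longleftrightarrow> SL = {0})"
    obtain TR TL where qe: "q = (TR, TL)" by force
    have T: "kron_envelope_pair M U TR TL" "TR = {0} \<longleftrightarrow> TL = {0}" using q by (auto simp: qe)
    then have sT: "subspace TR" "subspace TL" and TF: "(TR, TL) \<in> F"
      by (auto simp: kron_envelope_pair_def F_def)
    have sub: "TR \<otimes>\<^sub>K TL \<subseteq> SR \<otimes>\<^sub>K SL" using T(1) S by (auto simp: kron_envelope_pair_def)
    show "q = (SR, SL)"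
    proof (cases "TR = {0}")
      case True
      then show ?thesis
        using T(2) least[OF TF] subspace_0[OF S(1)] subspace_0[OF S(2)] by (auto simp: qe)
    next
      case False
      then have "TR \<subseteq> SR" "TL \<subseteq> SL"
        using kron_space_subset_factors[OF sT S(1,2) sub] T(2) by auto
      then show ?thesis using least[OF TF] by (auto simp: qe)
    qed
  qed
qed

lemma kron_envelope_pair_factors:
  "kron_envelope_pair M U (kron_envelope_right M U) (kron_envelope_left M U)"
  "kron_envelope_right M U = {0} \<longleftrightarrow> kron_envelope_left M U = {0}"
  using theI'[OF kron_envelope_factors_ex1[of M U], folded kron_envelope_factors_def]
  by (simp_all add: kron_envelope_right_def kron_envelope_left_def case_prod_beta)

lemma kron_envelope_unique:
  assumes "kron_envelope_pair M U SR SL"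
  shows "SR \<otimes>\<^sub>K SL = kron_envelope M U"
  using assms kron_envelope_pair_factors(1)[of M U]
  unfolding kron_envelope_def kron_envelope_pair_def by (intro subset_antisym) simp_all

end

theory Submission
  imports Defs
begin

text \<open>
  Let \<open>S\<^sub>L\<close> and \<open>S\<^sub>R\<close> be the central left and right folding subspaces. The matrix \<open>P\<^sub>L X P\<^sub>R\<close> and the
  projection of \<open>vec X\<close> onto \<open>S\<^sub>R \<otimes> S\<^sub>L\<close> are the same object in two notations
  (\<open>proj_mat_kron_space\<close>), and vectorization is a measurable bijection with measurable inverse, so
  that passing from one notation to the other changes no sigma-algebra
  (\<open>cond_indep_var_reparametrize\<close>). Hence, as \<open>(S\<^sub>L, S\<^sub>R)\<close> is a folding pair, \<open>S\<^sub>R \<otimes> S\<^sub>L\<close> is a dimension reduction subspace for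
  \<open>vec X\<close>, and the central subspace of \<open>vec X\<close>, being the intersection of all of those, lies in
  \<open>S\<^sub>R \<otimes> S\<^sub>L\<close>.

  It follows that \<open>span U \<subseteq> S\<^sub>R \<otimes> S\<^sub>L\<close> almost surely, and the minimality of the Kronecker envelope
  gives its inclusion in \<open>S\<^sub>R \<otimes> S\<^sub>L\<close>. The inclusion passes to the factors because a nonzero Kronecker
  product of subspaces determines them, and because both factors of a zero envelope are \<open>{0}\<close>.
\<close>

lemma proj_mat_eqI:
  fixes S :: "(real^'n::finite) set"
  assumes S: "subspace S" and y: "y \<in> S" and orth: "\<And>s. s \<in> S \<Longrightarrow> orthogonal (x - y) s"
  shows "proj_mat S *v x = y"
proof -
  define d where "d = proj_mat S *v x - y"
  have "d \<in> S"
    using proj_mat(1)[OF S] y S by (simp add: d_def subspace_diff)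
  then have "(x - y) \<bullet> d = 0" "(x - proj_mat S *v x) \<bullet> d = 0"
    using orth proj_mat(2)[OF S] by (auto simp: orthogonal_def)
  then have "d \<bullet> d = 0" by (simp add: d_def inner_diff_left)
  then show ?thesis by (simp add: d_def)
qed

lemma proj_mat_self_adjoint:
  fixes S :: "(real^'n::finite) set"
  assumes S: "subspace S"
  shows "(proj_mat S *v x) \<bullet> y = x \<bullet> (proj_mat S *v y)"
proof -
  have "(x - proj_mat S *v x) \<bullet> (proj_mat S *v y) = 0"
    "(y - proj_mat S *v y) \<bullet> (proj_mat S *v x) = 0"
    using proj_mat[OF S] by (auto simp: orthogonal_def)
  then have "x \<bullet> (proj_mat S *v y) = (proj_mat S *v x) \<bullet> (proj_mat S *v y)"
    "y \<bullet> (proj_mat S *v x) = (proj_mat S *v y) \<bullet> (proj_mat S *v x)"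
    by (simp_all add: inner_diff_left)
  then show ?thesis by (metis inner_commute)
qed

lemma transpose_proj_mat:
  fixes S :: "(real^'n::finite) set"
  assumes "subspace S"
  shows "transpose (proj_mat S) = proj_mat S"
proof -
  have "(y v* proj_mat S) \<bullet> x = (proj_mat S *v y) \<bullet> x" for x y
    by (simp add: dot_lmul_matrix proj_mat_self_adjoint[OF assms])
  then have "transpose (proj_mat S) *v y = proj_mat S *v y" for y
    using vector_eq_rdot by (metis transpose_matrix_vector)
  then show ?thesis by (simp add: matrix_eq)
qed

lemma proj_mat_fixes:
  fixes S :: "(real^'n::finite) set"
  assumes "subspace S" "x \<in> S"
  shows "proj_mat S *v x = x"
  using assms by (intro proj_mat_eqI) (auto simp: orthogonal_def)

lemma inner_vectorize_kron:
  fixes A :: "real^'r::finite^'l::finite"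
  shows "vectorize A \<bullet> kron v w = (A *v v) \<bullet> w"
proof -
  have "vectorize A \<bullet> kron v w = (\<Sum>j\<in>UNIV. \<Sum>i\<in>UNIV. A $ i $ j * (v $ j * w $ i))"
    by (simp add: vectorize_def kron_def inner_vec_def sum.cartesian_product case_prod_beta)
  also have "\<dots> = (\<Sum>i\<in>UNIV. \<Sum>j\<in>UNIV. A $ i $ j * (v $ j * w $ i))"
    by (rule sum.swap)
  also have "\<dots> = (A *v v) \<bullet> w"
    by (simp add: matrix_vector_mult_def inner_vec_def sum_distrib_right mult.assoc)
  finally show ?thesis .
qed

text \<open>
  This is \<open>P\<^bsub>S\<^sub>R \<otimes> S\<^sub>L\<^esub> = P\<^sub>R \<otimes> P\<^sub>L\<close> applied to \<open>vec A\<close>. The columns of \<open>P\<^sub>L A P\<^sub>R\<close> lie in \<open>S\<^sub>L\<close> and, by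
  symmetry of \<open>P\<^sub>R\<close>, its rows lie in \<open>S\<^sub>R\<close>, so its vectorization lies in \<open>S\<^sub>R \<otimes> S\<^sub>L\<close>. The residual is
  orthogonal to each generator \<open>v \<otimes> w\<close> because the inner product of \<open>vec A\<close> with it is the
  bilinear form \<open>w\<^sup>T A v\<close>, and \<open>P\<^sub>R v = v\<close>, \<open>P\<^sub>L w = w\<close>.
\<close>

lemma proj_mat_kron_space:
  fixes A :: "real^'r::finite^'l::finite"
  assumes R: "subspace SR" and L: "subspace SL"
  shows "proj_mat (SR \<otimes>\<^sub>K SL) *v vectorize A = vectorize (proj_mat SL ** A ** proj_mat SR)"
proof (rule proj_mat_eqI)
  let ?B = "proj_mat SL ** A ** proj_mat SR"
  show "subspace (SR \<otimes>\<^sub>K SL)" by (rule subspace_kron_space)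
  have "(\<chi> i. vectorize ?B $ (j, i)) = proj_mat SL *v ((A ** proj_mat SR) *v axis j 1)" for j
  proof -
    have "proj_mat SL *v ((A ** proj_mat SR) *v axis j 1) = ?B *v axis j 1"
      by (simp only: matrix_vector_mul_assoc matrix_mul_assoc)
    also have "\<dots> = (\<chi> i. vectorize ?B $ (j, i))"
      by (simp add: vectorize_def vec_eq_iff matrix_vector_mult_basis column_def)
    finally show ?thesis by simp
  qed
  moreover
  have "(\<chi> j. vectorize ?B $ (j, i)) = proj_mat SR *v (transpose (proj_mat SL ** A) *v axis i 1)" for i
  proof -
    have "proj_mat SR *v (transpose (proj_mat SL ** A) *v axis i 1) = transpose ?B *v axis i 1"
      by (simp add: matrix_vector_mul_assoc matrix_transpose_mul transpose_proj_mat[OF R])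
    also have "\<dots> = (\<chi> j. vectorize ?B $ (j, i))"
      by (simp add: vectorize_def vec_eq_iff matrix_vector_mult_basis column_def transpose_def)
    finally show ?thesis by simp
  qed
  ultimately show "vectorize ?B \<in> SR \<otimes>\<^sub>K SL"
    using proj_mat(1)[OF L] proj_mat(1)[OF R] by (simp add: mem_kron_space_iff[OF R L])
  have gen: "orthogonal (vectorize A - vectorize ?B) z"
    if mem: "z \<in> {kron v w | v w. v \<in> SR \<and> w \<in> SL}" for z
  proof -
    obtain v w where z: "z = kron v w" "v \<in> SR" "w \<in> SL" using mem by auto
    have "?B *v v = proj_mat SL *v (A *v v)"
      by (simp add: proj_mat_fixes[OF R z(2)] flip: matrix_vector_mul_assoc)
    then have "(?B *v v) \<bullet> w = (A *v v) \<bullet> w"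
      by (simp add: proj_mat_self_adjoint[OF L] proj_mat_fixes[OF L z(3)])
    then show ?thesis
      by (simp add: z(1) orthogonal_def inner_diff_left inner_vectorize_kron)
  qed
  show "orthogonal (vectorize A - vectorize ?B) s" if "s \<in> SR \<otimes>\<^sub>K SL" for s
    using orthogonal_to_span[OF that[unfolded kron_space_def] gen] .
qed

lemma vimage_algebra_reparametrize:
  assumes g: "g \<in> measurable L L'" and h: "h \<in> measurable L' L"
    and inv: "\<And>z. z \<in> space L \<Longrightarrow> h (g z) = z" and Z: "Z \<in> \<Omega> \<rightarrow> space L"
  shows "vimage_algebra \<Omega> (\<lambda>\<omega>. g (Z \<omega>)) L' = vimage_algebra \<Omega> Z L"
proof -
  have "{(\<lambda>\<omega>. g (Z \<omega>)) -` A \<inter> \<Omega> | A. A \<in> sets L'} = {Z -` A \<inter> \<Omega> | A. A \<in> sets L}"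
  proof (intro subset_antisym subsetI)
    fix C assume "C \<in> {(\<lambda>\<omega>. g (Z \<omega>)) -` A \<inter> \<Omega> | A. A \<in> sets L'}"
    then obtain A where A: "A \<in> sets L'" "C = (\<lambda>\<omega>. g (Z \<omega>)) -` A \<inter> \<Omega>" by auto
    moreover have "C = Z -` (g -` A \<inter> space L) \<inter> \<Omega>" using A Z by auto
    ultimately show "C \<in> {Z -` A \<inter> \<Omega> | A. A \<in> sets L}" using measurable_sets[OF g] by blast
  next
    fix C assume "C \<in> {Z -` A \<inter> \<Omega> | A. A \<in> sets L}"
    then obtain A where A: "A \<in> sets L" "C = Z -` A \<inter> \<Omega>" by auto
    moreover have "C = (\<lambda>\<omega>. g (Z \<omega>)) -` (h -` A \<inter> space L') \<inter> \<Omega>"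
      using A Z inv measurable_space[OF g] by (auto simp: Pi_iff)
    ultimately show "C \<in> {(\<lambda>\<omega>. g (Z \<omega>)) -` A \<inter> \<Omega> | A. A \<in> sets L'}"
      using measurable_sets[OF h] by blast
  qed
  then show ?thesis by (simp add: vimage_algebra_def)
qed

text \<open>
  A measurable image of \<open>X\<close> generates no new events, so it stays independent of \<open>Y\<close>, but the image of the conditioning variable
  \<open>Z\<close> must still carry all of its information; the measurable left inverse \<open>h\<close> ensures this.
  A space \<open>K\<close> that fills its type keeps the preimages of \<open>X\<close>, which are taken in the whole type
  and not in \<open>space M\<close>, literally unchanged.
\<close>

lemma cond_indep_var_reparametrize:
  assumes indep: "cond_indep_var M N Y K X L Z" and K: "space K = UNIV"
    and f: "f \<in> measurable K K'"
    and g: "g \<in> measurable L L'" and h: "h \<in> measurable L' L"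
    and inv: "\<And>z. z \<in> space L \<Longrightarrow> h (g z) = z"
  shows "cond_indep_var M N Y K' (\<lambda>\<omega>. f (X \<omega>)) L' (\<lambda>\<omega>. g (Z \<omega>))"
proof -
  have meas: "Y \<in> measurable M N" "X \<in> measurable M K" "Z \<in> measurable M L"
    using indep by (auto simp: cond_indep_var_def)
  have alg: "vimage_algebra (space M) (\<lambda>\<omega>. g (Z \<omega>)) L' = vimage_algebra (space M) Z L"
    using g h inv by (rule vimage_algebra_reparametrize) (use measurable_space[OF meas(3)] in auto)
  have pre: "(\<lambda>\<omega>. f (X \<omega>)) -` B = X -` (f -` B)" for B
    by auto
  have "f -` B \<in> sets K" if "B \<in> sets K'" for B
    using measurable_sets[OF f that] K by simp
  then show ?thesis
    using indep meas f g
    by (auto simp: cond_indep_var_def alg pre intro: measurable_compose)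
qed

lemma
  shows borel_measurable_vectorize:
      "(vectorize :: real^'r::finite^'l::finite \<Rightarrow> _) \<in> borel_measurable borel"
    and borel_measurable_unvectorize:
      "(\<lambda>v. \<chi> i j. v $ (j, i) :: real^'r::finite^'l::finite) \<in> borel_measurable borel"
  unfolding vectorize_def
  by (intro borel_measurable_continuous_onI continuous_intros)+

lemma dim_reduction_subspace_kron_space:
  assumes "dim_folding_pair M N Y X SL SR"
  shows "dim_reduction_subspace M N Y (\<lambda>\<omega>. vectorize (X \<omega>)) (SR \<otimes>\<^sub>K SL)"
proof -
  have S: "subspace SR" "subspace SL"
    and indep: "cond_indep_var M N Y borel X borel (\<lambda>\<omega>. proj_mat SL ** X \<omega> ** proj_mat SR)"
    using assms by (auto simp: dim_folding_pair_def)
  have "cond_indep_var M N Y borel (\<lambda>\<omega>. vectorize (X \<omega>)) borel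
      (\<lambda>\<omega>. vectorize (proj_mat SL ** X \<omega> ** proj_mat SR))"
    by (rule cond_indep_var_reparametrize[OF indep _ borel_measurable_vectorize
          borel_measurable_vectorize borel_measurable_unvectorize])
      (simp_all add: vectorize_def vec_eq_iff)
  then show ?thesis
    by (simp add: dim_reduction_subspace_def subspace_kron_space proj_mat_kron_space[OF S])
qed

theorem theorem2:
  fixes M :: "'a measure" and N :: "'y measure"
    and X :: "'a \<Rightarrow> real^'r::finite^'l::finite" and Y :: "'a \<Rightarrow> 'y"
    and U :: "'a \<Rightarrow> real^'k::finite^('r \<times> 'l)"
  assumes "prob_space M"
    and "X \<in> borel_measurable M" and "Y \<in> measurable M N" and "U \<in> borel_measurable M"
    and "dim_folding_pair M N Y X (central_left_folding M N Y X) (central_right_folding M N Y X)"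
    and "dim_reduction_subspace M N Y (\<lambda>\<omega>. vectorize (X \<omega>))
           (central_subspace M N Y (\<lambda>\<omega>. vectorize (X \<omega>)))"
    and "AE \<omega> in M. span (columns (U \<omega>)) \<subseteq> central_subspace M N Y (\<lambda>\<omega>. vectorize (X \<omega>))"
  shows "kron_envelope M U \<subseteq> central_folding_subspace M N Y X \<and>
         kron_envelope_left M U \<subseteq> central_left_folding M N Y X \<and>
         kron_envelope_right M U \<subseteq> central_right_folding M N Y X"
proof -
  let ?SL = "central_left_folding M N Y X" and ?SR = "central_right_folding M N Y X"
  let ?EL = "kron_envelope_left M U" and ?ER = "kron_envelope_right M U"
  have S: "subspace ?SR" "subspace ?SL"
    using assms(5) by (auto simp: dim_folding_pair_def)
  have E: "subspace ?ER" "subspace ?EL"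
    using kron_envelope_pair_factors(1)[of M U] by (auto simp: kron_envelope_pair_def)
  have central: "central_subspace M N Y (\<lambda>\<omega>. vectorize (X \<omega>)) \<subseteq> ?SR \<otimes>\<^sub>K ?SL"
    using dim_reduction_subspace_kron_space[OF assms(5)] by (auto simp: central_subspace_def)
  from assms(7) have "AE \<omega> in M. span (columns (U \<omega>)) \<subseteq> ?SR \<otimes>\<^sub>K ?SL"
    by eventually_elim (rule subset_trans[OF _ central])
  \<comment> \<open>minimality of the envelope against the competitor \<open>(S\<^sub>R, S\<^sub>L)\<close>\<close>
  then have sub: "?ER \<otimes>\<^sub>K ?EL \<subseteq> ?SR \<otimes>\<^sub>K ?SL"
    using kron_envelope_pair_factors(1)[of M U] S unfolding kron_envelope_pair_def by blast
  have "?ER \<subseteq> ?SR \<and> ?EL \<subseteq> ?SL"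
  \<comment> \<open>a zero product says nothing about its factors, so that case rests on \<open>?EL = {0} = ?ER\<close>\<close>
  proof (cases "?ER = {0}")
    case True
    then show ?thesis
      using kron_envelope_pair_factors(2)[of M U] S by (auto simp: subspace_0)
  next
    case False
    then show ?thesis
      using kron_space_subset_factors[OF E S sub] kron_envelope_pair_factors(2)[of M U] by auto
  qed
  then show ?thesis
    using sub by (simp add: kron_envelope_def central_folding_subspace_def)
qed

end
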